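(* For each integer $e\ge1$ let $A_e$ and $B_e$ be as defined in the context. Then $B_e<A_e$ for every $e\ge1$, and $B_{e_1+e_2}<B_{e_1}B_{e_2}$ for all integers $e_1,e_2\ge1$.
   Context: For real $x\ne0$, $y$, let $\Omega(x,y)=\sum_{n\in\mathbb{Z}}\max(0,1-|xn-y|)^2$. For $e\ge1$, $A_e^4$ is the global minimum value (it is attained) over $(\sigma_1,\ldots,\sigma_e)\in(0,\infty)^e$ of $-\frac{2^e}{3^e}\prod_{j=1}^e\sigma_j+2\prod_{j=1}^e\Omega(1/\sigma_j,0)$, and $A_e>0$; this is the minimum asymptotic value of $\|f\|_4/\|f\|_2$ over size-stable families of $e$-variable non-quadratic multiplicative character polynomials. $B_e^4$ is the global minimum value (it is attained) over $(\sigma_1,\ldots,\sigma_e)\in(0,\infty)^e$, $(\tau_1,\ldots,\tau_e)\in\mathbb{R}^e$ of $-\frac{2^{e+1}}{3^e}\prod_{j=1}^e\sigma_j+2\prod_{j=1}^e\Omega(1/\sigma_j,0)+\prod_{j=1}^e\Omega(1/\sigma_j,1+2\tau_j/\sigma_j)$, and $B_e>0$; this is the minimum asymptotic value of $\|f\|_4/\|f\|_2$ over size- and translation-stable families of $e$-variable quadratic multiplicative character polynomials (polynomials $\sum_{j\in S}\chi(\alpha(j+t))z^j$ with $\chi$ a multiplicative character of $\mathbb{F}_{p^e}$, extended by $\chi(0)=0$, $S$ a box $\prod_k\{0,\ldots,s_k-1\}$, $t\in\mathbb{Z}^e$, $\alpha:\mathbb{Z}^e\to\mathbb{F}_{p^e}$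 an additive epimorphism, in the limit $p\to\infty$ with $s_k/p\to\sigma_k$, $t_k/p\to\tau_k$). *)

theory Defs
  imports "HOL-Analysis.Infinite_Sum" "HOL-Library.FuncSet"
begin

text \<open>Only meaningful for \<open>x \<noteq> 0\<close>, where all but finitely many summands vanish.\<close>

definition Omega :: "real \<Rightarrow> real \<Rightarrow> real" where
  "Omega x y = (\<Sum>\<^sub>\<infinity>n\<in>(UNIV :: int set). (max 0 (1 - \<bar>x * of_int n - y\<bar>))\<^sup>2)"

definition is_min_value :: "('a \<Rightarrow> real) \<Rightarrow> 'a set \<Rightarrow> real \<Rightarrow> bool" where
  "is_min_value f S m \<longleftrightarrow> m \<in> f ` S \<and> (\<forall>x\<in>S. m \<le> f x)"

text \<open>An \<open>e\<close>-tuple of reals is a function on \<open>{1..e}\<close>, extensional outside that set.\<close>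

definition pos_tuples :: "nat \<Rightarrow> (nat \<Rightarrow> real) set" where
  "pos_tuples e = {1..e} \<rightarrow>\<^sub>E {0<..}"

definition real_tuples :: "nat \<Rightarrow> (nat \<Rightarrow> real) set" where
  "real_tuples e = {1..e} \<rightarrow>\<^sub>E UNIV"

definition A_objective :: "nat \<Rightarrow> (nat \<Rightarrow> real) \<Rightarrow> real" where
  "A_objective e \<sigma> =
     - (2 ^ e / 3 ^ e) * (\<Prod>j=1..e. \<sigma> j)
     + 2 * (\<Prod>j=1..e. Omega (1 / \<sigma> j) 0)"

definition B_objective :: "nat \<Rightarrow> (nat \<Rightarrow> real) \<times> (nat \<Rightarrow> real) \<Rightarrow> real" where
  "B_objective e = (\<lambda>(\<sigma>, \<tau>).
     - (2 ^ (e + 1) / 3 ^ e) * (\<Prod>j=1..e. \<sigma> j)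
     + 2 * (\<Prod>j=1..e. Omega (1 / \<sigma> j) 0)
     + (\<Prod>j=1..e. Omega (1 / \<sigma> j) (1 + 2 * \<tau> j / \<sigma> j)))"

text \<open>
  There is at most one positive real whose fourth power is the minimum value, so the
  descriptions below denote it provided that the minimum is attained and positive;
  attainment and positivity are not assumed.
\<close>

definition A_val :: "nat \<Rightarrow> real" where
  "A_val e = (THE a. 0 < a \<and> is_min_value (A_objective e) (pos_tuples e) (a ^ 4))"

definition B_val :: "nat \<Rightarrow> real" where
  "B_val e = (THE b. 0 < b \<and>
     is_min_value (B_objective e) (pos_tuples e \<times> real_tuples e) (b ^ 4))"

end

(*
  Write G(s) = Omega(1/s,0), a(s) = 2s/3 (the mean of Omega(1/s,.) over a period) and
  w = Omega(1/s,y). Both objectives are linear in the products P, p, q of the values G, a, w,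
  namely 2P - p and 2P - 2p + q. The triples with q <= p <= P and P + q >= 2p are closed under
  componentwise multiplication, and against such a cofactor a coordinate s <= 1 or s >= 3/2 may be
  replaced by s = 1, and y by the midpoint 1/(2s), without increasing the objective. Hence both
  minima are attained on the compact cube [1,3/2]^e, where all functions are explicit.

  At an A-minimiser, moving to the midpoints gives q < p and so B_e < A_e. For the product
  inequality the concatenation of the two B-minimisers is used: the difference
  (2P1 - 2p1 + q1)(2P2 - 2p2 + q2) - (2 P1 P2 - 2 p1 p2 + q1 q2) equals
  (P1 - p1)(P2 + 2 q2 - 3 p2) + (P2 - p2)(P1 + 2 q1 - 3 p1), and P + 2q > 3p at a minimiser because
  on [1,3/2] one has s^2 (G + 2w - 3a) = (s-1)^2 (3-2s).
*)

theory Submission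
  imports Defs "HOL-Analysis.Function_Topology"
begin

section \<open>Truncated sums of squares\<close>

text \<open>\<open>cubic x\<close> is the Bernoulli polynomial \<open>B\<^sub>3(x + 1)\<close>, whose difference equation telescopes sums of squares.\<close>

definition cubic :: "real \<Rightarrow> real" where
  "cubic x = x * (x + 1 / 2) * (x + 1)"

text \<open>Since \<open>cubic x - cubic (x - 1) = 3 * x ^ 2\<close>, removing the term
  \<open>k = 0\<close> for a positive \<open>x\<close> moves both sides to \<open>x - 1\<close>. The
  descent ends in \<open>[-1, 0]\<close>, where the sum vanishes and only \<open>cubic\<close> is
  left; \<open>1 / 8\<close> is a crude estimate of it there.\<close>

lemma truncated_square_sum_bound:
  fixes x :: real
  assumes "- 1 \<le> x" "x \<le> real N"
  shows "\<bar>3 * (\<Sum>k<N. (max 0 (x - real k))\<^sup>2) - cubic x\<bar> \<le> 1 / 8"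
  using assms unfolding cubic_def
proof (induction N arbitrary: x)
  have small: "\<bar>x * (x + 1 / 2) * (x + 1)\<bar> \<le> 1 / 8" if "- 1 \<le> x" "x \<le> 0" for x :: real
  proof -
    have "\<bar>x * (x + 1)\<bar> \<le> 1 / 4"
    proof -
      have "x * (x + 1) \<le> 0" using that by (simp add: mult_le_0_iff)
      moreover have "x * (x + 1) + 1 / 4 = (x + 1 / 2)\<^sup>2" by (simp add: power2_eq_square field_simps)
      ultimately show ?thesis using zero_le_power2[of "x + 1 / 2"] by linarith
    qed
    moreover have "\<bar>x + 1 / 2\<bar> \<le> 1 / 2" using that by linarith
    ultimately have "\<bar>x * (x + 1)\<bar> * \<bar>x + 1 / 2\<bar> \<le> (1 / 4) * (1 / 2)"
      by (intro mult_mono) auto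
    then show ?thesis by (simp add: abs_mult mult_ac)
  qed
  {
    case 0
    then show ?case using small[of x] by simp
  next
    case (Suc N)
    show ?case
    proof (cases "x \<le> 0")
      case True
      then have "(\<Sum>k<Suc N. (max 0 (x - real k))\<^sup>2) = 0"
        by (intro sum.neutral) auto
      then show ?thesis using small[of x] Suc.prems True by simp
    next
      case False
      have "(\<Sum>k<Suc N. (max 0 (x - real k))\<^sup>2)
          = x\<^sup>2 + (\<Sum>k<N. (max 0 ((x - 1) - real k))\<^sup>2)"
        using False by (subst sum.lessThan_Suc_shift) (simp add: algebra_simps)
      moreover have "\<bar>3 * (\<Sum>k<N. (max 0 ((x - 1) - real k))\<^sup>2)
          - (x - 1) * ((x - 1) + 1 / 2) * ((x - 1) + 1)\<bar> \<le> 1 / 8"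
        using Suc.prems False by (intro Suc.IH) auto
      moreover have "x * (x + 1 / 2) * (x + 1)
          = 3 * x\<^sup>2 + (x - 1) * ((x - 1) + 1 / 2) * ((x - 1) + 1)"
        by (simp add: power2_eq_square field_simps)
      ultimately show ?thesis by simp
    qed
  }
qed

lemma truncated_square_sum_bounds:
  assumes "- 1 \<le> x" "x \<le> real N"
  shows "cubic x - 1 / 8 \<le> 3 * (\<Sum>k<N. (max 0 (x - real k))\<^sup>2)"
    and "3 * (\<Sum>k<N. (max 0 (x - real k))\<^sup>2) \<le> cubic x + 1 / 8"
  using truncated_square_sum_bound[OF assms] by linarith+

section \<open>Evaluation and lower bounds of \<open>Omega\<close>\<close>

lemma sum_symmetric_int_interval:
  fixes f :: "int \<Rightarrow> 'a::comm_monoid_add"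
  shows "sum f {c - int N..<c + int N} = (\<Sum>k<N. f (c + int k)) + (\<Sum>k<N. f (c - 1 - int k))"
proof (induction N)
  case (Suc N)
  have eq: "{c - int (Suc N)..<c + int (Suc N)}
      = insert (c + int N) (insert (c - 1 - int N) {c - int N..<c + int N})"
    by auto
  show ?case unfolding eq by (subst sum.insert; simp add: Suc.IH algebra_simps)+
qed simp

text \<open>The points \<open>n / s\<close> to the right and to the left of \<open>y\<close> are summed separately.\<close>

lemma Omega_eq:
  assumes s: "0 < s" and \<alpha>: "0 \<le> \<alpha>" "\<alpha> \<le> 1" and y: "y = (of_int c - \<alpha>) / s" and N: "s \<le> real N"
  shows "s\<^sup>2 * Omega (1 / s) y =
    (\<Sum>k<N. (max 0 (s - \<alpha> - real k))\<^sup>2) + (\<Sum>k<N. (max 0 (s - 1 + \<alpha> - real k))\<^sup>2)"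
proof -
  let ?g = "\<lambda>n::int. (max 0 (1 - \<bar>1 / s * of_int n - y\<bar>))\<^sup>2"
  have g: "s\<^sup>2 * ?g n = (max 0 (s - \<bar>of_int (n - c) + \<alpha>\<bar>))\<^sup>2" for n
  proof -
    have "1 / s * of_int n - y = (of_int (n - c) + \<alpha>) / s"
      using s unfolding y by (simp add: field_simps)
    then have "s * (1 - \<bar>1 / s * of_int n - y\<bar>) = s - \<bar>of_int (n - c) + \<alpha>\<bar>"
      using s by (simp add: abs_divide field_simps)
    moreover have "s * max 0 (1 - \<bar>1 / s * of_int n - y\<bar>) = max 0 (s * (1 - \<bar>1 / s * of_int n - y\<bar>))"
      using s by (simp add: max_mult_distrib_left)
    ultimately show ?thesis by (metis power_mult_distrib)
  qed
  have "?g n = 0" if "n \<notin> {c - int N..<c + int N}" for n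
  proof -
    \<comment> \<open>The half-open interval matters: to its left
      \<open>n - c + 1 \<le> - N\<close>, and \<open>\<alpha> \<le> 1\<close> absorbs the one; to
      its right \<open>0 \<le> \<alpha>\<close> does the work.\<close>
    have "n - c \<ge> int N \<or> n - c + 1 \<le> - int N" using that by auto
    then have "of_int (n - c) \<ge> real N \<or> of_int (n - c) + 1 \<le> - real N"
      by (metis of_int_1 of_int_add of_int_le_iff of_int_minus of_int_of_nat_eq)
    then have "s - \<bar>of_int (n - c) + \<alpha>\<bar> \<le> 0" using \<alpha> N by linarith
    then have "s\<^sup>2 * ?g n = 0" unfolding g by simp
    then show ?thesis using s by simp
  qed
  then have "Omega (1 / s) y = infsum ?g {c - int N..<c + int N}"
    unfolding Omega_def by (intro infsum_cong_neutral) auto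
  also have "\<dots> = sum ?g {c - int N..<c + int N}" by simp
  finally have "s\<^sup>2 * Omega (1 / s) y = (\<Sum>n\<in>{c - int N..<c + int N}. s\<^sup>2 * ?g n)"
    by (simp add: sum_distrib_left)
  also have "\<dots> = (\<Sum>k<N. s\<^sup>2 * ?g (c + int k)) + (\<Sum>k<N. s\<^sup>2 * ?g (c - 1 - int k))"
    by (rule sum_symmetric_int_interval)
  also have "\<dots> = (\<Sum>k<N. (max 0 (s - \<alpha> - real k))\<^sup>2) + (\<Sum>k<N. (max 0 (s - 1 + \<alpha> - real k))\<^sup>2)"
  proof -
    have 1: "s\<^sup>2 * ?g (c + int k) = (max 0 (s - \<alpha> - real k))\<^sup>2" for k
    proof -
      have "\<bar>of_int (c + int k - c) + \<alpha>\<bar> = real k + \<alpha>" using \<alpha> by simp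
      then show ?thesis unfolding g by (simp add: algebra_simps)
    qed
    have 2: "s\<^sup>2 * ?g (c - 1 - int k) = (max 0 (s - 1 + \<alpha> - real k))\<^sup>2" for k
    proof -
      have "\<bar>of_int (c - 1 - int k - c) + \<alpha>\<bar> = real k + 1 - \<alpha>" using \<alpha> by simp
      then show ?thesis unfolding g by (simp add: algebra_simps)
    qed
    show ?thesis by (simp only: 1 2)
  qed
  finally show ?thesis .
qed

lemma lattice_offset:
  fixes s y :: real
  assumes "0 < s"
  obtains c :: int and \<alpha> where "0 \<le> \<alpha>" "\<alpha> \<le> 1" "y = (of_int c - \<alpha>) / s"
proof
  show "0 \<le> of_int \<lceil>s * y\<rceil> - s * y" "of_int \<lceil>s * y\<rceil> - s * y \<le> 1" by linarith+
  show "y = (of_int \<lceil>s * y\<rceil> - (of_int \<lceil>s * y\<rceil> - s * y)) / s" using assms by simp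
qed

lemma Omega_nonneg: "0 \<le> Omega x y"
  unfolding Omega_def by (intro infsum_nonneg) auto

text \<open>Only the two multiples of \<open>1 / s\<close> enclosing \<open>y\<close> are kept.
  Scaled by \<open>s ^ 2\<close>, they contribute \<open>u ^ 2 + v ^ 2\<close> with
  \<open>u + v \<ge> 2 * s - 1\<close>, which is at least half of \<open>(u + v) ^ 2\<close>. For
  \<open>1 \<le> s \<le> 3 / 2\<close> the midpoint attains the bound, see
  \<open>Omega_mid_medium\<close>.\<close>

lemma Omega_ge_two_point:
  assumes s: "1 / 2 \<le> s"
  shows "2 * (1 - 1 / (2 * s))\<^sup>2 \<le> Omega (1 / s) y"
proof -
  have s0: "0 < s" using s by linarith
  obtain c \<alpha> where \<alpha>: "0 \<le> \<alpha>" "\<alpha> \<le> 1" and y: "y = (of_int c - \<alpha>) / s"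
    using lattice_offset[OF s0] by blast
  obtain N where N: "s \<le> real N" using real_arch_simple by blast
  have first: "(max 0 x)\<^sup>2 \<le> (\<Sum>k<N. (max 0 (x - real k))\<^sup>2)" for x :: real
  proof -
    have "N \<noteq> 0" using N s0 by (cases N) auto
    then show ?thesis
      using member_le_sum[of 0 "{..<N}" "\<lambda>k. (max 0 (x - real k))\<^sup>2"] by simp
  qed
  have "(2 * s - 1)\<^sup>2 / 2 \<le> (max 0 (s - \<alpha>))\<^sup>2 + (max 0 (s - 1 + \<alpha>))\<^sup>2"
  proof -
    let ?u = "max 0 (s - \<alpha>)" and ?v = "max 0 (s - 1 + \<alpha>)"
    have "(2 * s - 1)\<^sup>2 \<le> (?u + ?v)\<^sup>2" using s by (intro power_mono) auto
    also have "\<dots> \<le> 2 * (?u\<^sup>2 + ?v\<^sup>2)"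
      using zero_le_power2[of "?u - ?v"] by (simp add: power2_eq_square algebra_simps)
    finally show ?thesis by simp
  qed
  also have "\<dots> \<le> s\<^sup>2 * Omega (1 / s) y"
    unfolding Omega_eq[OF s0 \<alpha> y N] by (intro add_mono first)
  also have "(2 * s - 1)\<^sup>2 / 2 = s\<^sup>2 * (2 * (1 - 1 / (2 * s))\<^sup>2)"
    using s0 by (simp add: power2_eq_square field_simps)
  finally have "s\<^sup>2 * (2 * (1 - 1 / (2 * s))\<^sup>2) \<le> s\<^sup>2 * Omega (1 / s) y" .
  then show ?thesis using s0 by simp
qed

text \<open>In the cubic approximation \<open>\<alpha>\<close> enters only through
  \<open>6 * s * (\<alpha> - 1 / 2) ^ 2\<close>, which is dropped; the two truncated sums cost
  \<open>1 / 8\<close> each.\<close>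

lemma Omega_lower:
  assumes s: "1 \<le> s"
  shows "2 * s / 3 - 1 / (6 * s) - 1 / (12 * s\<^sup>2) \<le> Omega (1 / s) y"
proof -
  have s0: "0 < s" using s by linarith
  obtain c \<alpha> where \<alpha>: "0 \<le> \<alpha>" "\<alpha> \<le> 1" and y: "y = (of_int c - \<alpha>) / s"
    using lattice_offset[OF s0] by blast
  obtain N where N: "s \<le> real N" using real_arch_simple by blast
  have "cubic (s - \<alpha>) + cubic (s - 1 + \<alpha>) - 1 / 4 \<le> 3 * (s\<^sup>2 * Omega (1 / s) y)"
    unfolding Omega_eq[OF s0 \<alpha> y N]
    using truncated_square_sum_bounds(1)[of "s - \<alpha>" N]
      truncated_square_sum_bounds(1)[of "s - 1 + \<alpha>" N] s \<alpha> N by simp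
  moreover have "cubic (s - \<alpha>) + cubic (s - 1 + \<alpha>) = 2 * s ^ 3 + 6 * s * (\<alpha> - 1 / 2)\<^sup>2 - s / 2"
    by (simp add: cubic_def power2_eq_square power3_eq_cube field_simps)
  moreover have "0 \<le> 6 * s * (\<alpha> - 1 / 2)\<^sup>2" using s0 by simp
  ultimately have "2 * s ^ 3 - s / 2 - 1 / 4 \<le> 3 * (s\<^sup>2 * Omega (1 / s) y)" by linarith
  moreover have "3 * s\<^sup>2 * (2 * s / 3 - 1 / (6 * s) - 1 / (12 * s\<^sup>2)) = 2 * s ^ 3 - s / 2 - 1 / 4"
    using s0 by (simp add: power2_eq_square power3_eq_cube field_simps)
  ultimately have "3 * s\<^sup>2 * (2 * s / 3 - 1 / (6 * s) - 1 / (12 * s\<^sup>2)) \<le> 3 * s\<^sup>2 * Omega (1 / s) y"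
    by simp
  moreover have "0 < 3 * s\<^sup>2" using s0 by simp
  ultimately show ?thesis by (rule mult_left_le_imp_le)
qed

text \<open>At \<open>\<alpha> = 0\<close> the term dropped in \<open>Omega_lower\<close> equals
  \<open>3 * s / 2\<close>. Keeping it raises that bound by \<open>1 / (2 * s)\<close>.\<close>

lemma Omega_zero_lower:
  assumes s: "1 \<le> s"
  shows "2 * s / 3 + 1 / (3 * s) - 1 / (12 * s\<^sup>2) \<le> Omega (1 / s) 0"
proof -
  have s0: "0 < s" using s by linarith
  obtain N where N: "s \<le> real N" using real_arch_simple by blast
  have "s\<^sup>2 * Omega (1 / s) 0 = (\<Sum>k<N. (max 0 (s - 0 - real k))\<^sup>2) + (\<Sum>k<N. (max 0 (s - 1 + 0 - real k))\<^sup>2)"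
    by (rule Omega_eq[where c = 0]) (use s0 N in auto)
  then have "cubic s + cubic (s - 1) - 1 / 4 \<le> 3 * (s\<^sup>2 * Omega (1 / s) 0)"
    using truncated_square_sum_bounds(1)[of s N] truncated_square_sum_bounds(1)[of "s - 1" N] s N
    by simp
  moreover have "cubic s + cubic (s - 1) = 2 * s ^ 3 + s"
    by (simp add: cubic_def power3_eq_cube field_simps)
  moreover have "3 * s\<^sup>2 * (2 * s / 3 + 1 / (3 * s) - 1 / (12 * s\<^sup>2)) = 2 * s ^ 3 + s - 1 / 4"
    using s0 by (simp add: power2_eq_square power3_eq_cube field_simps)
  ultimately have "3 * s\<^sup>2 * (2 * s / 3 + 1 / (3 * s) - 1 / (12 * s\<^sup>2)) \<le> 3 * s\<^sup>2 * Omega (1 / s) 0"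
    by simp
  moreover have "0 < 3 * s\<^sup>2" using s0 by simp
  ultimately show ?thesis by (rule mult_left_le_imp_le)
qed

lemma Omega_zero_small:
  assumes "0 < s" "s \<le> 1"
  shows "Omega (1 / s) 0 = 1"
proof -
  have "s\<^sup>2 * Omega (1 / s) 0 = (\<Sum>k<1. (max 0 (s - 0 - real k))\<^sup>2) + (\<Sum>k<1. (max 0 (s - 1 + 0 - real k))\<^sup>2)"
    by (rule Omega_eq[where c = 0]) (use assms in auto)
  then show ?thesis using assms by simp
qed

lemma Omega_zero_medium:
  assumes "1 \<le> s" "s \<le> 2"
  shows "Omega (1 / s) 0 = 1 + 2 * (1 - 1 / s)\<^sup>2"
proof -
  have "s\<^sup>2 * Omega (1 / s) 0 = (\<Sum>k<2. (max 0 (s - 0 - real k))\<^sup>2) + (\<Sum>k<2. (max 0 (s - 1 + 0 - real k))\<^sup>2)"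
    by (rule Omega_eq[where c = 0]) (use assms in auto)
  also have "\<dots> = s\<^sup>2 * (1 + 2 * (1 - 1 / s)\<^sup>2)"
    using assms by (simp add: numeral_2_eq_2 power2_eq_square field_simps)
  finally have "s\<^sup>2 * Omega (1 / s) 0 = s\<^sup>2 * (1 + 2 * (1 - 1 / s)\<^sup>2)" .
  then show ?thesis using assms by simp
qed

text \<open>The midpoint of 0 and \<open>1 / s\<close> has \<open>c = 1\<close> and
  \<open>\<alpha> = 1 / 2\<close>, for which the two half sums coincide.\<close>

lemma Omega_mid_eq:
  assumes s: "0 < s" and N: "s \<le> real N"
  shows "s\<^sup>2 * Omega (1 / s) (1 / (2 * s)) = 2 * (\<Sum>k<N. (max 0 (s - 1 / 2 - real k))\<^sup>2)"
proof -
  have "s\<^sup>2 * Omega (1 / s) (1 / (2 * s)) =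
      (\<Sum>k<N. (max 0 (s - 1 / 2 - real k))\<^sup>2) + (\<Sum>k<N. (max 0 (s - 1 + 1 / 2 - real k))\<^sup>2)"
    by (rule Omega_eq[where c = 1]) (use s N in \<open>auto simp: field_simps\<close>)
  then show ?thesis by simp
qed

lemma Omega_mid_medium:
  assumes "1 \<le> s" "s \<le> 3 / 2"
  shows "Omega (1 / s) (1 / (2 * s)) = 2 * (1 - 1 / (2 * s))\<^sup>2"
proof -
  have "s\<^sup>2 * Omega (1 / s) (1 / (2 * s)) = s\<^sup>2 * (2 * (1 - 1 / (2 * s))\<^sup>2)"
    using assms by (subst Omega_mid_eq[where N = 2])
      (simp_all add: numeral_2_eq_2 power2_eq_square field_simps)
  then show ?thesis using assms by simp
qed

section \<open>Comparison of \<open>Omega\<close> with its mean and with its values at scale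
  1\<close>

text \<open>Up to \<open>s = 1 / 2\<close> the midpoint value is 0. Beyond it, the cubic estimate of
  \<open>3 * s ^ 2\<close> times the value is \<open>2 * s ^ 3 - s / 2 + 1 / 4\<close>, and the
  lower order part is not positive.\<close>

lemma Omega_mid_le:
  assumes s: "0 < s"
  shows "Omega (1 / s) (1 / (2 * s)) \<le> 2 * s / 3"
proof (cases "s \<le> 1 / 2")
  case True
  then have "s\<^sup>2 * Omega (1 / s) (1 / (2 * s)) = 0"
    using s by (subst Omega_mid_eq[where N = 1]) auto
  then show ?thesis using s by simp
next
  case False
  obtain N where N: "s \<le> real N" using real_arch_simple by blast
  let ?x = "s - 1 / 2"
  have "3 * (s\<^sup>2 * Omega (1 / s) (1 / (2 * s))) \<le> 2 * (cubic ?x + 1 / 8)"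
    unfolding Omega_mid_eq[OF s N] using truncated_square_sum_bounds(2)[of ?x N] False N by simp
  also have "\<dots> = 2 * s ^ 3 - s / 2 + 1 / 4"
    by (simp add: cubic_def power3_eq_cube field_simps)
  also have "\<dots> \<le> 3 * (s\<^sup>2 * (2 * s / 3))"
    using False by (simp add: power2_eq_square power3_eq_cube)
  finally show ?thesis using s by simp
qed

lemma Omega_zero_ge:
  assumes s: "0 < s"
  shows "2 * s / 3 < Omega (1 / s) 0" "1 \<le> Omega (1 / s) 0"
proof -
  have "2 * s / 3 < Omega (1 / s) 0 \<and> 1 \<le> Omega (1 / s) 0"
  proof (cases "s \<le> 1")
    case True
    then show ?thesis using s by (simp add: Omega_zero_small)
  next
    case False
    have "1 / (12 * s\<^sup>2) < 1 / (3 * s)"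
      using False by (simp add: power2_eq_square field_simps)
    then have "2 * s / 3 < Omega (1 / s) 0" using Omega_zero_lower[of s] False by linarith
    moreover have "1 \<le> Omega (1 / s) 0"
    proof (cases "s \<le> 3 / 2")
      case True
      then show ?thesis using False by (simp add: Omega_zero_medium)
    qed (use \<open>2 * s / 3 < Omega (1 / s) 0\<close> in linarith)
    ultimately show ?thesis by simp
  qed
  then show "2 * s / 3 < Omega (1 / s) 0" "1 \<le> Omega (1 / s) 0" by auto
qed

text \<open>This is the last condition of \<open>cone\<close> for a single coordinate. Below
  \<open>1 / 2\<close> the value 1 of the first summand suffices; up to 1 the two-point bound is
  added; beyond 1 the two cubic bounds leave a surplus \<open>(s - 1) / (6 * s ^ 2)\<close>.\<close>

lemma Omega_zero_plus_Omega_ge: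
  assumes s: "0 < s"
  shows "2 * (2 * s / 3) \<le> Omega (1 / s) 0 + Omega (1 / s) y"
proof -
  consider "s \<le> 1 / 2" | "1 / 2 \<le> s" "s \<le> 1" | "1 \<le> s" by linarith
  then show ?thesis
  proof cases
    case 1
    then show ?thesis using s Omega_zero_small[of s] Omega_nonneg[of "1 / s" y] by simp
  next
    case 2
    have "4 * s / 3 \<le> 1 + 2 * (1 - 1 / (2 * s))\<^sup>2"
    proof -
      define t where "t = 1 / s"
      have t: "1 \<le> t" "s = 1 / t" using 2 by (auto simp: t_def field_simps)
      \<comment> \<open>The left side is \<open>6 * t\<close> times the difference to be shown
        nonnegative; at \<open>t = 1\<close> it equals 1.\<close>
      have eq: "18 * t - 12 * t\<^sup>2 + 3 * t ^ 3 - 8 = (t - 1) * (3 * (t - 3 / 2)\<^sup>2 + 9 / 4) + 1"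
        by (simp add: power2_eq_square power3_eq_cube field_simps)
      have ge: "0 \<le> (t - 1) * (3 * (t - 3 / 2)\<^sup>2 + 9 / 4)" using t by simp
      have "0 \<le> 18 * t - 12 * t\<^sup>2 + 3 * t ^ 3 - 8"
        unfolding eq by (rule add_nonneg_nonneg[OF ge]) simp
      then have "4 * (1 / t) / 3 \<le> 1 + 2 * (1 - t / 2)\<^sup>2"
        using t(1) by (simp add: power2_eq_square power3_eq_cube field_simps)
      then show ?thesis by (simp add: t_def mult.commute)
    qed
    then show ?thesis using 2 s Omega_zero_small[of s] Omega_ge_two_point[of s y] by simp
  next
    case 3
    have "0 \<le> 1 / (3 * s) - 1 / (12 * s\<^sup>2) - 1 / (6 * s) - 1 / (12 * s\<^sup>2)"
      using 3 by (simp add: power2_eq_square field_simps)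
    then show ?thesis using Omega_zero_lower[OF 3] Omega_lower[OF 3, of y] by linarith
  qed
qed

text \<open>The constants \<open>4 / 3\<close> and \<open>7 / 6\<close> are the left-hand quantities
  at \<open>s = 1\<close>, with the midpoint for \<open>y\<close> in the second. So in one variable
  a scale of at least \<open>3 / 2\<close> is worse than scale 1 for both objectives.\<close>

lemma large_scale_bounds:
  assumes s: "3 / 2 \<le> s"
  shows "4 / 3 < 2 * Omega (1 / s) 0 - 2 * s / 3"
    and "7 / 6 < 2 * (Omega (1 / s) 0 - 2 * s / 3) + Omega (1 / s) y"
proof -
  define t where "t = 1 / s"
  have t: "0 < t" "t \<le> 2 / 3" "s = 1 / t" using s by (auto simp: t_def field_simps)
  have G: "2 * s / 3 + t / 3 - t\<^sup>2 / 12 \<le> Omega (1 / s) 0"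
    using Omega_zero_lower[of s] s by (simp add: t_def power_divide)
  have W: "2 - 2 * t + t\<^sup>2 / 2 \<le> Omega (1 / s) y"
    using Omega_ge_two_point[of s y] s by (simp add: t_def power2_eq_square field_simps)
  \<comment> \<open>Times \<open>6 * t\<close> the difference is
    \<open>4 * (1 - t) ^ 2 - t ^ 3\<close>, at least \<open>4 / 9 - 8 / 27\<close> for
    \<open>t \<le> 2 / 3\<close>.\<close>
  have "4 / 3 < 2 * s / 3 + (2 * t / 3 - t\<^sup>2 / 6)"
  proof -
    have "t ^ 3 \<le> (2 / 3) ^ 3" using t by (intro power_mono) auto
    moreover have "(1 / 3)\<^sup>2 \<le> (1 - t)\<^sup>2" using t by (intro power_mono) auto
    ultimately have "0 < 4 * (1 - t)\<^sup>2 - t ^ 3" by (simp add: power_divide)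
    then have "4 / 3 < 2 * (1 / t) / 3 + (2 * t / 3 - t\<^sup>2 / 6)"
      using t(1) by (simp add: power2_eq_square power3_eq_cube field_simps)
    then show ?thesis using t(3) by simp
  qed
  then show "4 / 3 < 2 * Omega (1 / s) 0 - 2 * s / 3" using G by linarith
  \<comment> \<open>The quadratic that must be positive has the value \<open>5 / 54\<close> at the
    end point \<open>t = 2 / 3\<close>; the rest factors.\<close>
  have "0 < (2 / 3 - t) * (10 / 3 - t) / 3 + 5 / 54"
    using t by (intro add_nonneg_pos) auto
  then have "7 / 6 < (2 * t / 3 - t\<^sup>2 / 6) + (2 - 2 * t + t\<^sup>2 / 2)"
    by (simp add: power2_eq_square field_simps)
  then show "7 / 6 < 2 * (Omega (1 / s) 0 - 2 * s / 3) + Omega (1 / s) y"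
    using G W unfolding right_diff_distrib by linarith
qed

text \<open>Here \<open>1 / 2\<close> is the midpoint value at scale 1 and
  \<open>4 / 3 * (1 - s)\<close> is the growth of twice the mean from \<open>s\<close> to 1. Raising
  \<open>s\<close> to 1 thus costs no more in the third product than it gains in the second.\<close>

lemma small_scale_bound:
  assumes s: "0 < s" "s \<le> 1"
  shows "1 / 2 - Omega (1 / s) y \<le> 4 / 3 * (1 - s)"
proof (cases "s \<le> 1 / 2")
  case True
  then have "1 / 2 \<le> 4 / 3 * (1 - s)" by simp
  then show ?thesis using Omega_nonneg[of "1 / s" y] by linarith
next
  case False
  define t where "t = 1 / s"
  have t: "1 \<le> t" "s = 1 / t" using s by (auto simp: t_def field_simps)
  \<comment> \<open>With the two-point bound inserted, \<open>6 * t\<close> times the required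
    difference is \<open>(t - 1) * (3 * t ^ 2 - 9 * t + 8)\<close>.\<close>
  have "3 * t\<^sup>2 - 9 * t + 8 = 3 * (t - 3 / 2)\<^sup>2 + 5 / 4"
    by (simp add: power2_eq_square field_simps)
  then have "0 \<le> 3 * t\<^sup>2 - 9 * t + 8" by simp
  then have "0 \<le> (t - 1) * (3 * t\<^sup>2 - 9 * t + 8)" using t by simp
  then have "1 / 2 - 2 * (1 - t / 2)\<^sup>2 \<le> 4 / 3 * (1 - 1 / t)"
    using t(1) by (simp add: power2_eq_square field_simps)
  moreover have "2 * (1 - t / 2)\<^sup>2 \<le> Omega (1 / s) y"
    using Omega_ge_two_point[of s y] False by (simp add: t_def mult.commute)
  ultimately show ?thesis unfolding t(2)[symmetric] by linarith
qed


section \<open>Multiplicative closure of the cone and coordinatewise exchange\<close>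

definition cone :: "real \<Rightarrow> real \<Rightarrow> real \<Rightarrow> bool" where
  "cone P p q \<longleftrightarrow> 0 \<le> q \<and> q \<le> p \<and> p \<le> P \<and> 2 * p \<le> P + q"

text \<open>With \<open>P = p + D\<close> and \<open>G = a + d\<close>, either one of
  \<open>D\<close>, \<open>d\<close> is so large that \<open>P * G\<close> alone suffices, or both
  deficits \<open>c * p - D \<le> c * q\<close> and \<open>c * a - d \<le> c * w\<close> are
  nonnegative and can be multiplied. The case \<open>c = 1\<close> yields \<open>cone_mult\<close>;
  \<open>c = 2\<close> yields \<open>box_excess\<close>, where the extra product
  \<open>(P - p) * (G - a)\<close> supplies strictness.\<close>

lemma weighted_excess_mult:
  fixes c :: real
  assumes c: "0 < c" and "0 \<le> p" "p \<le> P" "0 \<le> q" "0 \<le> a" "a \<le> G" "0 \<le> w"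
    and pq: "(1 + c) * p \<le> P + c * q" and aw: "(1 + c) * a \<le> G + c * w"
  shows "(1 + c) * (p * a) + (P - p) * (G - a) \<le> P * G + c * (q * w)"
proof -
  define D d where "D = P - p" and "d = G - a"
  have D: "0 \<le> D" "P = p + D" and d: "0 \<le> d" "G = a + d" using assms by (auto simp: D_def d_def)
  have PG: "P * G = p * a + p * d + D * a + D * d" unfolding D d by (simp add: algebra_simps)
  have Dd: "(P - p) * (G - a) = D * d" by (simp add: D_def d_def)
  have nn: "0 \<le> p * d" "0 \<le> D * a" "0 \<le> D * d" "0 \<le> c * (q * w)"
    using assms D d by auto
  consider "c * p \<le> D" | "c * a \<le> d" | "D \<le> c * p" "d \<le> c * a" by linarith
  then show ?thesis
  proof cases
    case 1
    then have "c * p * a \<le> D * a" using assms by (intro mult_right_mono) auto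
    then show ?thesis unfolding PG Dd using nn by (simp add: algebra_simps)
  next
    case 2
    then have "p * (c * a) \<le> p * d" using assms by (intro mult_left_mono) auto
    then show ?thesis unfolding PG Dd using nn by (simp add: algebra_simps)
  next
    case 3
    have "c * p - D \<le> c * q" "c * a - d \<le> c * w" using pq aw D d by (simp_all add: algebra_simps)
    then have "(c * p - D) * (c * a - d) \<le> (c * q) * (c * w)"
      using 3 assms by (intro mult_mono) auto
    moreover have "(c * p - D) * (c * a - d) = c * (c * (p * a) - p * d - D * a) + D * d"
      by (simp add: algebra_simps)
    ultimately have "c * (c * (p * a) - p * d - D * a) \<le> c * (c * (q * w))"
      using nn by (simp add: mult_ac)
    then have "c * (p * a) - p * d - D * a \<le> c * (q * w)" using c by simp
    then show ?thesis unfolding PG Dd by (simp add: algebra_simps)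
  qed
qed

lemma cone_mult:
  assumes "cone P p q" "cone G a w"
  shows "cone (P * G) (p * a) (q * w)"
proof -
  have "2 * (p * a) + (P - p) * (G - a) \<le> P * G + q * w"
    using weighted_excess_mult[of 1 p P q a G w] assms by (simp add: cone_def)
  moreover have "0 \<le> (P - p) * (G - a)" using assms by (simp add: cone_def)
  moreover have "q * w \<le> p * a" using assms unfolding cone_def by (auto intro!: mult_mono)
  moreover have "p * a \<le> P * G" using assms unfolding cone_def by (intro mult_mono) auto
  moreover have "0 \<le> q * w" using assms by (simp add: cone_def)
  ultimately show ?thesis unfolding cone_def by linarith
qed

lemma cone_one: "cone 1 1 1"
  by (simp add: cone_def)

lemma cone_prod:
  assumes "finite I" "\<And>j. j \<in> I \<Longrightarrow> cone (G j) (a j) (w j)"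
  shows "cone (prod G I) (prod a I) (prod w I)"
  using assms by (induction I rule: finite_induct) (auto simp: cone_one cone_mult)

text \<open>Coordinates are exchanged one at a time. When \<open>i\<close> is exchanged, its
  cofactor mixes original entries (collected in \<open>P\<close>, \<open>p\<close>,
  \<open>q\<close>) with primed ones still to be treated, hence the cone condition on both families
  and the induction over arbitrary cofactors.\<close>

lemma prod_functional_mono:
  fixes \<alpha> \<beta> \<gamma> P p q :: real
  assumes "finite I" "cone P p q"
    and "\<And>j. j \<in> I \<Longrightarrow> cone (G j) (a j) (w j)" "\<And>j. j \<in> I \<Longrightarrow> cone (G' j) (a' j) (w' j)"
    and "\<And>j P p q. \<lbrakk>j \<in> I; cone P p q\<rbrakk> \<Longrightarrow>
      \<alpha> * (P * G' j) + \<beta> * (p * a' j) + \<gamma> * (q * w' j) \<le> \<alpha> * (P * G j) + \<beta> * (p * a j) + \<gamma> * (q * w j)"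
  shows "\<alpha> * (P * prod G' I) + \<beta> * (p * prod a' I) + \<gamma> * (q * prod w' I)
    \<le> \<alpha> * (P * prod G I) + \<beta> * (p * prod a I) + \<gamma> * (q * prod w I)"
  using assms
proof (induction I arbitrary: P p q rule: finite_induct)
  case (insert i I)
  have "cone (P * prod G' I) (p * prod a' I) (q * prod w' I)"
    using insert.prems by (intro cone_mult cone_prod insert.hyps) auto
  from insert.prems(4)[OF insertI1 this]
  have "\<alpha> * (P * prod G' (insert i I)) + \<beta> * (p * prod a' (insert i I)) + \<gamma> * (q * prod w' (insert i I))
      \<le> \<alpha> * ((P * G i) * prod G' I) + \<beta> * ((p * a i) * prod a' I) + \<gamma> * ((q * w i) * prod w' I)"
    using insert.hyps by (simp add: mult_ac)
  also have "\<dots> \<le> \<alpha> * ((P * G i) * prod G I) + \<beta> * ((p * a i) * prod a I) + \<gamma> * ((q * w i) * prod w I)"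
    using insert.prems by (intro insert.IH cone_mult) auto
  finally show ?case using insert.hyps by (simp add: mult_ac)
qed simp

section \<open>Moving one coordinate into \<open>[1, 3 / 2]\<close>\<close>

text \<open>This is not the nearest-point projection: scales from \<open>3 / 2\<close> upwards also
  go to 1, the scale to which \<open>large_scale_bounds\<close> compares them.\<close>

definition clip :: "real \<Rightarrow> real" where
  "clip s = (if 1 < s \<and> s < 3 / 2 then s else 1)"

lemma clip_bounds: "1 \<le> clip s" "clip s \<le> 3 / 2"
  by (auto simp: clip_def)

lemma Omega_cone:
  assumes "0 < s" "Omega (1 / s) y \<le> 2 * s / 3"
  shows "cone (Omega (1 / s) 0) (2 * s / 3) (Omega (1 / s) y)"
  using assms Omega_zero_ge[of s] Omega_nonneg[of "1 / s" y] Omega_zero_plus_Omega_ge[of s y]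
  by (simp add: cone_def)

text \<open>For \<open>s \<le> 1\<close> the first product is unchanged and \<open>q \<le> p\<close>
  lets \<open>small_scale_bound\<close> apply. In the middle range only \<open>y\<close> moves, to
  the midpoint. For \<open>s \<ge> 3 / 2\<close>, \<open>P\<close> is first lowered to
  \<open>2 * p - q\<close>, which is possible because
  \<open>Omega (1 / s) 0 \<ge> 1\<close>.\<close>

lemma clip_step_B:
  assumes s: "0 < s" and K: "cone P p q"
  shows "2 * (P * Omega (1 / clip s) 0) + - 2 * (p * (2 * clip s / 3))
      + 1 * (q * Omega (1 / clip s) (1 / (2 * clip s)))
    \<le> 2 * (P * Omega (1 / s) 0) + - 2 * (p * (2 * s / 3)) + 1 * (q * Omega (1 / s) y)"
proof -
  have K': "0 \<le> q" "q \<le> p" "p \<le> P" "2 * p - q \<le> P" using K by (auto simp: cone_def)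
  have one: "Omega 1 0 = 1" "Omega 1 (1 / 2) = 1 / 2"
    using Omega_zero_small[of 1] Omega_mid_medium[of 1] by (simp_all add: power2_eq_square)
  let ?G = "Omega (1 / s) 0" and ?w = "Omega (1 / s) y"
  consider "s \<le> 1" | "1 < s" "s < 3 / 2" | "3 / 2 \<le> s" by linarith
  then show ?thesis
  proof cases
    case 1
    then have "q * (1 / 2 - ?w) \<le> q * (4 / 3 * (1 - s))"
      using small_scale_bound[of s y] s K' by (intro mult_left_mono) auto
    also have "\<dots> \<le> p * (4 / 3 * (1 - s))"
      using 1 K' by (intro mult_right_mono) auto
    finally show ?thesis using 1 s by (simp add: clip_def one Omega_zero_small algebra_simps)
  next
    case 2
    have "Omega (1 / s) (1 / (2 * s)) \<le> ?w"
      using 2 Omega_mid_medium[of s] Omega_ge_two_point[of s y] by simp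
    then show ?thesis using 2 K' by (simp add: clip_def mult_left_mono)
  next
    case 3
    note L = large_scale_bounds[OF 3]
    have "(2 * p - q) * (?G - 1) \<le> P * (?G - 1)"
      using K' Omega_zero_ge(2)[OF s] by (intro mult_right_mono) auto
    \<comment> \<open>Written in the nonnegative quantities \<open>p - q\<close> and
      \<open>q\<close>, the remainder has as coefficients twice the first and once the second
      surplus of \<open>large_scale_bounds\<close>.\<close>
    moreover have "0 \<le> (p - q) * (4 * (?G - 1) - 2 * (2 * s / 3 - 2 / 3))
        + q * (2 * (?G - 1) - 2 * (2 * s / 3 - 2 / 3) + ?w - 1 / 2)"
      using K' L(1) L(2)[of y] by (intro add_nonneg_nonneg mult_nonneg_nonneg) auto
    moreover have "2 * (P * ?G) - 2 * (p * (2 * s / 3)) + q * ?w - (2 * P - p * (4 / 3) + q / 2)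
        = 2 * (P * (?G - 1) - (2 * p - q) * (?G - 1))
          + ((p - q) * (4 * (?G - 1) - 2 * (2 * s / 3 - 2 / 3))
            + q * (2 * (?G - 1) - 2 * (2 * s / 3 - 2 / 3) + ?w - 1 / 2))"
      by (simp add: algebra_simps add_divide_distrib diff_divide_distrib)
    ultimately show ?thesis using 3 by (simp add: clip_def one)
  qed
qed

text \<open>For \<open>s \<ge> 3 / 2\<close>, lowering \<open>P\<close> to \<open>p\<close> leaves
  \<open>p\<close> times the first surplus of \<open>large_scale_bounds\<close>. The summands with
  factor 0 give the shape of \<open>prod_functional_mono\<close>.\<close>

lemma clip_step_A:
  assumes s: "0 < s" and K: "cone P p q"
  shows "2 * (P * Omega (1 / clip s) 0) + - 1 * (p * (2 * clip s / 3)) + 0 * (q * w')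
    \<le> 2 * (P * Omega (1 / s) 0) + - 1 * (p * (2 * s / 3)) + 0 * (q * w)"
proof -
  have K': "0 \<le> p" "p \<le> P" using K by (auto simp: cone_def)
  have one: "Omega 1 0 = 1" using Omega_zero_small[of 1] by simp
  let ?G = "Omega (1 / s) 0"
  consider "s \<le> 1" | "1 < s" "s < 3 / 2" | "3 / 2 \<le> s" by linarith
  then show ?thesis
  proof cases
    case 1
    then have "p * s \<le> p * 1" using K' by (intro mult_left_mono) auto
    then show ?thesis using 1 s by (simp add: clip_def one Omega_zero_small)
  next
    case 3
    have "p * (2 * (?G - 1)) \<le> P * (2 * (?G - 1))"
      using K' Omega_zero_ge(2)[OF s] by (intro mult_right_mono) auto
    moreover have "0 \<le> p * (2 * ?G - 2 * s / 3 - 4 / 3)"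
      using K' large_scale_bounds(1)[OF 3] by (intro mult_nonneg_nonneg) auto
    ultimately show ?thesis using 3 by (simp add: clip_def one algebra_simps)
  qed (simp add: clip_def)
qed

section \<open>Explicit products on the cube and existence of minimisers\<close>

definition scale_box :: "nat \<Rightarrow> (nat \<Rightarrow> real) set" where
  "scale_box e = {1..e} \<rightarrow>\<^sub>E {1..3 / 2}"

text \<open>The factors are the closed form of \<open>Omega (1 / s) 0\<close> on the cube;
  \<open>qprod\<close> does the same for the midpoint values. Rational functions make continuity
  immediate.\<close>

definition Pprod :: "nat \<Rightarrow> (nat \<Rightarrow> real) \<Rightarrow> real" where
  "Pprod e \<sigma> = (\<Prod>j=1..e. 1 + 2 * (1 - 1 / \<sigma> j)\<^sup>2)"

definition pprod :: "nat \<Rightarrow> (nat \<Rightarrow> real) \<Rightarrow> real" where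
  "pprod e \<sigma> = (\<Prod>j=1..e. 2 * \<sigma> j / 3)"

definition qprod :: "nat \<Rightarrow> (nat \<Rightarrow> real) \<Rightarrow> real" where
  "qprod e \<sigma> = (\<Prod>j=1..e. 2 * (1 - 1 / (2 * \<sigma> j))\<^sup>2)"

text \<open>The weights \<open>(2, -1, 0)\<close> give the A-objective and \<open>(2, -2, 1)\<close>
  the B-objective at midpoints.\<close>

lemma box_attains_min:
  "\<exists>\<sigma>\<in>scale_box e. \<forall>\<sigma>'\<in>scale_box e.
    \<alpha> * Pprod e \<sigma> + \<beta> * pprod e \<sigma> + \<gamma> * qprod e \<sigma> \<le> \<alpha> * Pprod e \<sigma>' + \<beta> * pprod e \<sigma>' + \<gamma> * qprod e \<sigma>'"
proof (rule continuous_attains_inf)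
  \<comment> \<open>Extensional tuples take the value \<open>undefined\<close> outside
    \<open>{1..e}\<close>, so the cube is a full product with singleton factors there and Tychonoff
    applies.\<close>
  let ?S = "\<lambda>i. if i \<in> {1..e} then {1..3 / 2 :: real} else {undefined}"
  have "scale_box e = Pi\<^sub>E UNIV ?S"
    unfolding scale_box_def by (auto simp: PiE_def Pi_def extensional_def split: if_splits)
  moreover have "compactin (product_topology (\<lambda>_. euclidean) UNIV) (Pi\<^sub>E UNIV ?S)"
    unfolding compactin_PiE by auto
  ultimately show "compact (scale_box e)" by (simp add: euclidean_product_topology)
  have "(\<lambda>j\<in>{1..e}. 1) \<in> scale_box e" by (auto simp: scale_box_def)
  then show "scale_box e \<noteq> {}" by blast
  have "\<sigma> j \<noteq> 0" if "\<sigma> \<in> scale_box e" "j \<in> {1..e}" for \<sigma> j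
    using that by (force simp: scale_box_def PiE_def Pi_def)
  moreover have "continuous_on (scale_box e) (\<lambda>\<sigma>. \<sigma> j)" for j
    by (rule continuous_on_subset[OF continuous_on_product_coordinates]) simp
  ultimately show "continuous_on (scale_box e) (\<lambda>\<sigma>. \<alpha> * Pprod e \<sigma> + \<beta> * pprod e \<sigma> + \<gamma> * qprod e \<sigma>)"
    unfolding Pprod_def pprod_def qprod_def by (intro continuous_intros) auto
qed

text \<open>The identity shows that on \<open>[1, 3 / 2]\<close> the excess over three times the
  mean vanishes exactly at the two end points.\<close>

lemma box_facts:
  assumes "1 \<le> s" "s \<le> 3 / 2"
  shows "2 * s / 3 < 1 + 2 * (1 - 1 / s)\<^sup>2" "2 * (1 - 1 / (2 * s))\<^sup>2 < 2 * s / 3"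
    and "cone (1 + 2 * (1 - 1 / s)\<^sup>2) (2 * s / 3) (2 * (1 - 1 / (2 * s))\<^sup>2)"
    and "s\<^sup>2 * (1 + 2 * (1 - 1 / s)\<^sup>2 + 2 * (2 * (1 - 1 / (2 * s))\<^sup>2) - 2 * s) = (s - 1)\<^sup>2 * (3 - 2 * s)"
    and "3 * (2 * s / 3) \<le> 1 + 2 * (1 - 1 / s)\<^sup>2 + 2 * (2 * (1 - 1 / (2 * s))\<^sup>2)"
proof -
  have s: "0 < s" using assms by simp
  show 1: "2 * s / 3 < 1 + 2 * (1 - 1 / s)\<^sup>2"
    using Omega_zero_ge(1)[OF s] Omega_zero_medium[of s] assms by simp
  show "cone (1 + 2 * (1 - 1 / s)\<^sup>2) (2 * s / 3) (2 * (1 - 1 / (2 * s))\<^sup>2)"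
    using Omega_cone[OF s Omega_mid_le[OF s]] Omega_zero_medium[of s] Omega_mid_medium[of s] assms
    by simp
  show 4: "s\<^sup>2 * (1 + 2 * (1 - 1 / s)\<^sup>2 + 2 * (2 * (1 - 1 / (2 * s))\<^sup>2) - 2 * s) = (s - 1)\<^sup>2 * (3 - 2 * s)"
    using s by (simp add: power2_eq_square field_simps)
  have "0 \<le> (s - 1)\<^sup>2 * (3 - 2 * s)" using assms by simp
  then have "0 \<le> 1 + 2 * (1 - 1 / s)\<^sup>2 + 2 * (2 * (1 - 1 / (2 * s))\<^sup>2) - 2 * s"
    using s by (simp add: zero_le_mult_iff flip: 4)
  then show "3 * (2 * s / 3) \<le> 1 + 2 * (1 - 1 / s)\<^sup>2 + 2 * (2 * (1 - 1 / (2 * s))\<^sup>2)" by simp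
  \<comment> \<open>\<open>Omega_mid_le\<close> is not strict. Times \<open>s ^ 2\<close> the gap is
    \<open>2 / 3 * (s - 1) ^ 3 + 1 / 6\<close>.\<close>
  have "s\<^sup>2 * (2 * (1 - 1 / (2 * s))\<^sup>2) < s\<^sup>2 * (2 * s / 3)"
  proof -
    have "s\<^sup>2 * (2 * (1 - 1 / (2 * s))\<^sup>2) = 2 * s\<^sup>2 - 2 * s + 1 / 2"
      using s by (simp add: power2_eq_square field_simps)
    moreover have "s\<^sup>2 * (2 * s / 3) - (2 * s\<^sup>2 - 2 * s + 1 / 2) = (s - 1) * (2 / 3 * (s - 1)\<^sup>2) + 1 / 6"
      by (simp add: power2_eq_square field_simps)
    moreover have "0 \<le> (s - 1) * (2 / 3 * (s - 1)\<^sup>2)" using assms by simp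
    ultimately show ?thesis by simp
  qed
  then show "2 * (1 - 1 / (2 * s))\<^sup>2 < 2 * s / 3" using s by simp
qed

lemma boxD: "\<sigma> \<in> scale_box e \<Longrightarrow> j \<in> {1..e} \<Longrightarrow> 1 \<le> \<sigma> j \<and> \<sigma> j \<le> 3 / 2"
  by (auto simp: scale_box_def PiE_def Pi_def)

lemma box_subset_pos_tuples: "scale_box e \<subseteq> pos_tuples e"
  unfolding scale_box_def pos_tuples_def by (rule PiE_mono) auto

lemma box_products:
  assumes "\<sigma> \<in> scale_box e"
  shows "cone (Pprod e \<sigma>) (pprod e \<sigma>) (qprod e \<sigma>)"
    and "1 \<le> e \<Longrightarrow> pprod e \<sigma> < Pprod e \<sigma>" "1 \<le> e \<Longrightarrow> qprod e \<sigma> < pprod e \<sigma>"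
    and "1 \<le> Pprod e \<sigma>"
proof -
  note b = boxD[OF assms]
  show "cone (Pprod e \<sigma>) (pprod e \<sigma>) (qprod e \<sigma>)"
    unfolding Pprod_def pprod_def qprod_def using b box_facts(3) by (intro cone_prod) auto
  show "1 \<le> Pprod e \<sigma>"
    unfolding Pprod_def by (intro prod_ge_1) auto
  show "pprod e \<sigma> < Pprod e \<sigma>" if "1 \<le> e"
    unfolding Pprod_def pprod_def
    using b box_facts(1) that by (intro prod_mono_strict) (auto simp: less_imp_le add_pos_nonneg intro: order_trans[of 0 1])
  show "qprod e \<sigma> < pprod e \<sigma>" if "1 \<le> e"
    unfolding qprod_def pprod_def
    using b box_facts(2) that by (intro prod_mono_strict) (auto simp: less_imp_le intro: less_le_trans[of 0 1])
qed

section \<open>Reduction of both objectives to the cube\<close>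

lemma A_objective_eq:
  "A_objective e \<sigma> = 2 * (\<Prod>j=1..e. Omega (1 / \<sigma> j) 0) - (\<Prod>j=1..e. 2 * \<sigma> j / 3)"
  by (simp add: A_objective_def prod_dividef prod.distrib)

lemma B_objective_eq:
  "B_objective e (\<sigma>, \<tau>) = 2 * (\<Prod>j=1..e. Omega (1 / \<sigma> j) 0) - 2 * (\<Prod>j=1..e. 2 * \<sigma> j / 3)
    + (\<Prod>j=1..e. Omega (1 / \<sigma> j) (1 + 2 * \<tau> j / \<sigma> j))"
  by (simp add: B_objective_def prod_dividef prod.distrib)

lemma Omega_prods_box:
  assumes "\<sigma> \<in> scale_box e"
  shows "(\<Prod>j=1..e. Omega (1 / \<sigma> j) 0) = Pprod e \<sigma>"
    and "(\<Prod>j=1..e. Omega (1 / \<sigma> j) (1 / (2 * \<sigma> j))) = qprod e \<sigma>"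
proof -
  note b = boxD[OF assms]
  show "(\<Prod>j=1..e. Omega (1 / \<sigma> j) 0) = Pprod e \<sigma>"
    unfolding Pprod_def
  proof (intro prod.cong refl)
    fix j assume "j \<in> {1..e}"
    from b[OF this] show "Omega (1 / \<sigma> j) 0 = 1 + 2 * (1 - 1 / \<sigma> j)\<^sup>2"
      by (intro Omega_zero_medium) auto
  qed
  show "(\<Prod>j=1..e. Omega (1 / \<sigma> j) (1 / (2 * \<sigma> j))) = qprod e \<sigma>"
    unfolding qprod_def using b by (intro prod.cong refl Omega_mid_medium) auto
qed

text \<open>The shift \<open>\<tau> = 1/4 - \<sigma>/2\<close> makes \<open>1 + 2\<tau>/\<sigma>\<close> the midpoint \<open>1/(2\<sigma>)\<close> of two consecutive multiples of \<open>1/\<sigma>\<close>.\<close>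

definition mid_shift :: "nat \<Rightarrow> (nat \<Rightarrow> real) \<Rightarrow> nat \<Rightarrow> real" where
  "mid_shift e \<sigma> = (\<lambda>j\<in>{1..e}. 1 / 4 - \<sigma> j / 2)"

lemma mid_shift_in: "mid_shift e \<sigma> \<in> real_tuples e"
  by (simp add: mid_shift_def real_tuples_def)

lemma objectives_box:
  assumes "\<sigma> \<in> scale_box e"
  shows "A_objective e \<sigma> = 2 * Pprod e \<sigma> - pprod e \<sigma>"
    and "B_objective e (\<sigma>, mid_shift e \<sigma>) = 2 * Pprod e \<sigma> - 2 * pprod e \<sigma> + qprod e \<sigma>"
proof -
  show "A_objective e \<sigma> = 2 * Pprod e \<sigma> - pprod e \<sigma>"
    by (simp only: A_objective_eq Omega_prods_box(1)[OF assms] pprod_def)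
  have "(\<Prod>j=1..e. Omega (1 / \<sigma> j) (1 + 2 * mid_shift e \<sigma> j / \<sigma> j))
      = (\<Prod>j=1..e. Omega (1 / \<sigma> j) (1 / (2 * \<sigma> j)))"
  proof (intro prod.cong refl)
    fix j assume j: "j \<in> {1..e}"
    then have "1 + 2 * mid_shift e \<sigma> j / \<sigma> j = 1 / (2 * \<sigma> j)"
      using boxD[OF assms j] by (simp add: mid_shift_def field_simps)
    then show "Omega (1 / \<sigma> j) (1 + 2 * mid_shift e \<sigma> j / \<sigma> j) = Omega (1 / \<sigma> j) (1 / (2 * \<sigma> j))"
      by simp
  qed
  then show "B_objective e (\<sigma>, mid_shift e \<sigma>) = 2 * Pprod e \<sigma> - 2 * pprod e \<sigma> + qprod e \<sigma>"
    by (simp only: B_objective_eq Omega_prods_box[OF assms] pprod_def)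
qed

definition clip_tuple :: "nat \<Rightarrow> (nat \<Rightarrow> real) \<Rightarrow> nat \<Rightarrow> real" where
  "clip_tuple e \<sigma> = (\<lambda>j\<in>{1..e}. clip (\<sigma> j))"

lemma clip_tuple_box: "clip_tuple e \<sigma> \<in> scale_box e"
  using clip_bounds by (auto simp: clip_tuple_def scale_box_def)

lemma clip_cone: "cone (Omega (1 / clip s) 0) (2 * clip s / 3) (Omega (1 / clip s) (1 / (2 * clip s)))"
  using clip_bounds[of s] by (intro Omega_cone Omega_mid_le) auto

lemma clip_tuple_prods:
  "(\<Prod>j=1..e. Omega (1 / clip (\<sigma> j)) 0) = Pprod e (clip_tuple e \<sigma>)"
  "(\<Prod>j=1..e. 2 * clip (\<sigma> j) / 3) = pprod e (clip_tuple e \<sigma>)"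
  "(\<Prod>j=1..e. Omega (1 / clip (\<sigma> j)) (1 / (2 * clip (\<sigma> j)))) = qprod e (clip_tuple e \<sigma>)"
  unfolding Omega_prods_box[OF clip_tuple_box, symmetric] pprod_def
  by (intro prod.cong refl; simp add: clip_tuple_def)+

lemma clip_tuple_A:
  assumes "\<sigma> \<in> pos_tuples e"
  shows "A_objective e (clip_tuple e \<sigma>) \<le> A_objective e \<sigma>"
proof -
  have pos: "0 < \<sigma> j" if "j \<in> {1..e}" for j
    using assms that by (auto simp: pos_tuples_def PiE_def Pi_def)
  \<comment> \<open>The third product has weight 0; midpoints keep every triple in the cone by
    \<open>Omega_mid_le\<close>.\<close>
  let ?w = "\<lambda>j. Omega (1 / \<sigma> j) (1 / (2 * \<sigma> j))"
  have "2 * (1 * (\<Prod>j=1..e. Omega (1 / clip (\<sigma> j)) 0)) + - 1 * (1 * (\<Prod>j=1..e. 2 * clip (\<sigma> j) / 3))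
      + 0 * (1 * (\<Prod>j=1..e. Omega (1 / clip (\<sigma> j)) (1 / (2 * clip (\<sigma> j)))))
    \<le> 2 * (1 * (\<Prod>j=1..e. Omega (1 / \<sigma> j) 0)) + - 1 * (1 * (\<Prod>j=1..e. 2 * \<sigma> j / 3))
      + 0 * (1 * (\<Prod>j=1..e. ?w j))"
    using pos by (intro prod_functional_mono cone_one clip_step_A Omega_cone Omega_mid_le clip_cone) auto
  then show ?thesis
    unfolding objectives_box[OF clip_tuple_box] clip_tuple_prods by (simp add: A_objective_eq)
qed

lemma clip_tuple_B:
  assumes "\<sigma> \<in> pos_tuples e"
  shows "B_objective e (clip_tuple e \<sigma>, mid_shift e (clip_tuple e \<sigma>)) \<le> B_objective e (\<sigma>, \<tau>)"
proof -
  have pos: "0 < \<sigma> j" if "j \<in> {1..e}" for j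
    using assms that by (auto simp: pos_tuples_def PiE_def Pi_def)
  \<comment> \<open>A shift whose value exceeds the mean would leave the cone. It is replaced by the
    midpoint, which only lowers the objective.\<close>
  define y where "y j = (if Omega (1 / \<sigma> j) (1 + 2 * \<tau> j / \<sigma> j) \<le> 2 * \<sigma> j / 3
      then 1 + 2 * \<tau> j / \<sigma> j else 1 / (2 * \<sigma> j))" for j
  have y: "Omega (1 / \<sigma> j) (y j) \<le> 2 * \<sigma> j / 3"
      "Omega (1 / \<sigma> j) (y j) \<le> Omega (1 / \<sigma> j) (1 + 2 * \<tau> j / \<sigma> j)" if "j \<in> {1..e}" for j
    using Omega_mid_le[OF pos[OF that]] unfolding y_def by auto
  have "2 * (1 * (\<Prod>j=1..e. Omega (1 / clip (\<sigma> j)) 0)) + - 2 * (1 * (\<Prod>j=1..e. 2 * clip (\<sigma> j) / 3))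
      + 1 * (1 * (\<Prod>j=1..e. Omega (1 / clip (\<sigma> j)) (1 / (2 * clip (\<sigma> j)))))
    \<le> 2 * (1 * (\<Prod>j=1..e. Omega (1 / \<sigma> j) 0)) + - 2 * (1 * (\<Prod>j=1..e. 2 * \<sigma> j / 3))
      + 1 * (1 * (\<Prod>j=1..e. Omega (1 / \<sigma> j) (y j)))"
    using pos y(1) by (intro prod_functional_mono cone_one clip_step_B Omega_cone clip_cone) auto
  moreover have "(\<Prod>j=1..e. Omega (1 / \<sigma> j) (y j)) \<le> (\<Prod>j=1..e. Omega (1 / \<sigma> j) (1 + 2 * \<tau> j / \<sigma> j))"
    using y(2) Omega_nonneg by (intro prod_mono) auto
  ultimately show ?thesis
    unfolding objectives_box[OF clip_tuple_box] clip_tuple_prods by (simp add: B_objective_eq)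
qed

section \<open>Minimum values and their fourth roots\<close>

text \<open>Minimum values are unique, and so are positive fourth roots; with attainment and
  positivity the description is therefore proper.\<close>

lemma the_fourth_root_of_min:
  assumes "is_min_value f S m" "0 < m"
  defines "v \<equiv> (THE a. 0 < a \<and> is_min_value f S (a ^ 4))"
  shows "0 < v" "v ^ 4 = m"
proof -
  have unique: "m' = m" if "is_min_value f S m'" for m'
    using that assms(1) unfolding is_min_value_def by (auto intro: antisym)
  have "v = root 4 m"
    unfolding v_def
  proof (rule the_equality)
    show "0 < root 4 m \<and> is_min_value f S (root 4 m ^ 4)" using assms by simp
  next
    fix a assume "0 < a \<and> is_min_value f S (a ^ 4)"
    then show "a = root 4 m" using unique[of "a ^ 4"] by (auto intro: real_root_pos_unique[symmetric])
  qed
  then show "0 < v" "v ^ 4 = m" using assms(2) by simp_all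
qed

lemma A_val_box:
  obtains \<sigma> where "\<sigma> \<in> scale_box e" "0 < A_val e" "A_val e ^ 4 = 2 * Pprod e \<sigma> - pprod e \<sigma>"
proof -
  obtain \<sigma> where \<sigma>: "\<sigma> \<in> scale_box e" and min: "\<And>\<sigma>'. \<sigma>' \<in> scale_box e \<Longrightarrow> A_objective e \<sigma> \<le> A_objective e \<sigma>'"
    using box_attains_min[where e = e and \<alpha> = 2 and \<beta> = "- 1" and \<gamma> = 0] by (auto simp: objectives_box)
  have "A_objective e \<sigma> \<le> A_objective e \<sigma>'" if "\<sigma>' \<in> pos_tuples e" for \<sigma>'
    using min[OF clip_tuple_box] clip_tuple_A[OF that] by (rule order_trans)
  then have "is_min_value (A_objective e) (pos_tuples e) (A_objective e \<sigma>)"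
    using \<sigma> box_subset_pos_tuples unfolding is_min_value_def by blast
  moreover have "0 < A_objective e \<sigma>"
    using box_products(1,4)[OF \<sigma>] by (simp add: objectives_box[OF \<sigma>] cone_def)
  ultimately have "0 < A_val e" "A_val e ^ 4 = A_objective e \<sigma>"
    unfolding A_val_def by (rule the_fourth_root_of_min)+
  with \<sigma> that show ?thesis by (simp add: objectives_box)
qed

lemma B_val_box:
  assumes e: "1 \<le> e"
  obtains \<sigma> where "\<sigma> \<in> scale_box e" "0 < B_val e" "B_val e ^ 4 = 2 * Pprod e \<sigma> - 2 * pprod e \<sigma> + qprod e \<sigma>"
    "\<And>\<sigma>'. \<sigma>' \<in> scale_box e \<Longrightarrow> B_val e ^ 4 \<le> 2 * Pprod e \<sigma>' - 2 * pprod e \<sigma>' + qprod e \<sigma>'"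
proof -
  let ?F = "\<lambda>\<sigma>. B_objective e (\<sigma>, mid_shift e \<sigma>)"
  obtain \<sigma> where \<sigma>: "\<sigma> \<in> scale_box e" and min: "\<And>\<sigma>'. \<sigma>' \<in> scale_box e \<Longrightarrow> ?F \<sigma> \<le> ?F \<sigma>'"
    using box_attains_min[where e = e and \<alpha> = 2 and \<beta> = "- 2" and \<gamma> = 1] by (auto simp: objectives_box)
  have "?F \<sigma> \<le> B_objective e x" if "x \<in> pos_tuples e \<times> real_tuples e" for x
    using min[OF clip_tuple_box] clip_tuple_B that by (cases x) (blast intro: order_trans)
  moreover have "(\<sigma>, mid_shift e \<sigma>) \<in> pos_tuples e \<times> real_tuples e"
    using \<sigma> box_subset_pos_tuples mid_shift_in by blast
  ultimately have "is_min_value (B_objective e) (pos_tuples e \<times> real_tuples e) (?F \<sigma>)"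
    unfolding is_min_value_def by blast
  \<comment> \<open>Positivity comes from \<open>0 \<le> q\<close> and the strict inequality
    \<open>p < P\<close>, which holds because \<open>1 \<le> e\<close>.\<close>
  moreover have "0 < ?F \<sigma>"
    using box_products(1,2)[OF \<sigma>] e by (simp add: objectives_box[OF \<sigma>] cone_def)
  ultimately have "0 < B_val e" "B_val e ^ 4 = ?F \<sigma>"
    unfolding B_val_def by (rule the_fourth_root_of_min)+
  with \<sigma> that min show ?thesis by (simp add: objectives_box)
qed

section \<open>Strict excess \<open>P + 2 * q > 3 * p\<close> at minimisers\<close>

text \<open>Coordinates are added one by one through \<open>weighted_excess_mult\<close> with
  \<open>c = 2\<close>. Its extra product is positive as soon as an earlier coordinate exists, hence
  strictness from \<open>e = 2\<close> on.\<close>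

lemma box_excess:
  assumes "\<sigma> \<in> scale_box e"
  shows "3 * pprod e \<sigma> \<le> Pprod e \<sigma> + 2 * qprod e \<sigma>"
    and "2 \<le> e \<Longrightarrow> 3 * pprod e \<sigma> < Pprod e \<sigma> + 2 * qprod e \<sigma>"
proof -
  have step: "3 * pprod (Suc n) \<sigma> + (Pprod n \<sigma> - pprod n \<sigma>) * (G - a) \<le> Pprod (Suc n) \<sigma> + 2 * qprod (Suc n) \<sigma>"
    if n: "n < e" and IH: "3 * pprod n \<sigma> \<le> Pprod n \<sigma> + 2 * qprod n \<sigma>"
      and C: "cone (Pprod n \<sigma>) (pprod n \<sigma>) (qprod n \<sigma>)"
      and G: "G = 1 + 2 * (1 - 1 / \<sigma> (Suc n))\<^sup>2" and a: "a = 2 * \<sigma> (Suc n) / 3" for n G a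
  proof -
    have b: "1 \<le> \<sigma> (Suc n)" "\<sigma> (Suc n) \<le> 3 / 2" using boxD[OF assms, of "Suc n"] n by auto
    let ?w = "2 * (1 - 1 / (2 * \<sigma> (Suc n)))\<^sup>2"
    have "(1 + 2) * (pprod n \<sigma> * a) + (Pprod n \<sigma> - pprod n \<sigma>) * (G - a)
        \<le> Pprod n \<sigma> * G + 2 * (qprod n \<sigma> * ?w)"
      using box_facts[OF b] IH C b unfolding G a
      by (intro weighted_excess_mult) (auto simp: cone_def)
    then show ?thesis
      unfolding pprod_def Pprod_def qprod_def by (simp add: prod.nat_ivl_Suc' G a mult_ac)
  qed
  \<comment> \<open>Truncating the tuple to its first \<open>n\<close> entries makes
    \<open>box_products\<close> available for the partial products.\<close>
  have restrict_box: "restrict \<sigma> {1..n} \<in> scale_box n" if "n \<le> e" for n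
    using assms that by (auto simp: scale_box_def PiE_def Pi_def)
  have restrict_prod: "Pprod n (restrict \<sigma> {1..n}) = Pprod n \<sigma>"
      "pprod n (restrict \<sigma> {1..n}) = pprod n \<sigma>" "qprod n (restrict \<sigma> {1..n}) = qprod n \<sigma>" for n
    unfolding Pprod_def pprod_def qprod_def by (intro prod.cong refl; simp)+
  note sub = box_products[OF restrict_box, unfolded restrict_prod]
  have le: "n \<le> e \<Longrightarrow> 3 * pprod n \<sigma> \<le> Pprod n \<sigma> + 2 * qprod n \<sigma>" for n
  proof (induction n)
    case 0
    then show ?case by (simp add: pprod_def Pprod_def qprod_def)
  next
    case (Suc n)
    have "1 \<le> \<sigma> (Suc n)" "\<sigma> (Suc n) \<le> 3 / 2" using boxD[OF assms, of "Suc n"] Suc.prems by auto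
    note box_facts(1)[OF this]
    moreover have C: "cone (Pprod n \<sigma>) (pprod n \<sigma>) (qprod n \<sigma>)" using sub(1) Suc.prems by simp
    ultimately have "0 \<le> (Pprod n \<sigma> - pprod n \<sigma>) * (1 + 2 * (1 - 1 / \<sigma> (Suc n))\<^sup>2 - 2 * \<sigma> (Suc n) / 3)"
      by (intro mult_nonneg_nonneg) (auto simp: cone_def)
    then show ?case using step[OF _ Suc.IH C refl refl] Suc.prems by linarith
  qed
  show "3 * pprod e \<sigma> \<le> Pprod e \<sigma> + 2 * qprod e \<sigma>" by (rule le) simp
  assume "2 \<le> e"
  then obtain n where n: "e = Suc n" "1 \<le> n" by (cases e) auto
  have "1 \<le> \<sigma> (Suc n)" "\<sigma> (Suc n) \<le> 3 / 2" using boxD[OF assms, of "Suc n"] n by auto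
  note box_facts(1)[OF this]
  moreover have "pprod n \<sigma> < Pprod n \<sigma>" using sub(2) n by simp
  ultimately have "0 < (Pprod n \<sigma> - pprod n \<sigma>) * (1 + 2 * (1 - 1 / \<sigma> (Suc n))\<^sup>2 - 2 * \<sigma> (Suc n) / 3)"
    by (intro mult_pos_pos) auto
  moreover have "cone (Pprod n \<sigma>) (pprod n \<sigma>) (qprod n \<sigma>)" using sub(1) n by simp
  ultimately show "3 * pprod e \<sigma> < Pprod e \<sigma> + 2 * qprod e \<sigma>"
    using step[OF _ le _ refl refl, of n] n by (simp add: n(1))
qed

text \<open>The value \<open>21/20\<close> is close to the minimiser for \<open>e = 1\<close>; it beats both end points of \<open>[1, 3/2]\<close>.\<close>

lemma minimizer_excess:
  assumes e: "1 \<le> e" and \<sigma>: "\<sigma> \<in> scale_box e"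
    and min: "\<And>\<sigma>'. \<sigma>' \<in> scale_box e \<Longrightarrow>
      2 * Pprod e \<sigma> - 2 * pprod e \<sigma> + qprod e \<sigma> \<le> 2 * Pprod e \<sigma>' - 2 * pprod e \<sigma>' + qprod e \<sigma>'"
  shows "3 * pprod e \<sigma> < Pprod e \<sigma> + 2 * qprod e \<sigma>"
proof (cases "e = 1")
  case False
  then show ?thesis using e by (intro box_excess(2)[OF \<sigma>]) auto
next
  case True
  define s where "s = \<sigma> 1"
  have s: "1 \<le> s" "s \<le> 3 / 2" using boxD[OF \<sigma>, of 1] True by (auto simp: s_def)
  define f :: "real \<Rightarrow> real" where
    "f x = 2 * (1 + 2 * (1 - 1 / x)\<^sup>2) - 2 * (2 * x / 3) + 2 * (1 - 1 / (2 * x))\<^sup>2" for x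
  have "(\<lambda>j\<in>{1..e}. 21 / 20) \<in> scale_box e" by (auto simp: scale_box_def)
  from min[OF this] have "f s \<le> f (21 / 20)"
    by (simp add: Pprod_def pprod_def qprod_def True s_def f_def)
  moreover have "f (21 / 20) < f 1" "f (21 / 20) < f (3 / 2)"
    by (simp_all add: f_def power2_eq_square)
  ultimately have "s \<noteq> 1" "s \<noteq> 3 / 2" using not_le by blast+
  \<comment> \<open>The end points just excluded are the only zeros of the excess on
    \<open>[1, 3 / 2]\<close>.\<close>
  then have "0 < (s - 1)\<^sup>2 * (3 - 2 * s)" using s by simp
  then have "0 < 1 + 2 * (1 - 1 / s)\<^sup>2 + 2 * (2 * (1 - 1 / (2 * s))\<^sup>2) - 2 * s"
    using s by (simp add: zero_less_mult_iff flip: box_facts(4)[OF s])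
  then show ?thesis by (simp add: Pprod_def pprod_def qprod_def True s_def)
qed

section \<open>Concatenation and the two inequalities\<close>

definition concat_tuple :: "nat \<Rightarrow> nat \<Rightarrow> (nat \<Rightarrow> real) \<Rightarrow> (nat \<Rightarrow> real) \<Rightarrow> nat \<Rightarrow> real" where
  "concat_tuple m n \<sigma> \<sigma>' = (\<lambda>j\<in>{1..m + n}. if j \<le> m then \<sigma> j else \<sigma>' (j - m))"

lemma concat_tuple_box:
  assumes "\<sigma> \<in> scale_box m" "\<sigma>' \<in> scale_box n"
  shows "concat_tuple m n \<sigma> \<sigma>' \<in> scale_box (m + n)"
  unfolding scale_box_def
proof (rule PiE_I)
  fix j assume j: "j \<in> {1..m + n}"
  show "concat_tuple m n \<sigma> \<sigma>' j \<in> {1..3 / 2}"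
  proof (cases "j \<le> m")
    case True
    then show ?thesis using j boxD[OF assms(1), of j] by (simp add: concat_tuple_def)
  next
    case False
    then have "j - m \<in> {1..n}" using j by auto
    then show ?thesis using False j boxD[OF assms(2), of "j - m"] by (simp add: concat_tuple_def)
  qed
qed (auto simp: concat_tuple_def)

lemma prod_concat_tuple:
  fixes f :: "real \<Rightarrow> 'a::comm_monoid_mult"
  shows "(\<Prod>j=1..m + n. f (concat_tuple m n \<sigma> \<sigma>' j)) = (\<Prod>j=1..m. f (\<sigma> j)) * (\<Prod>j=1..n. f (\<sigma>' j))"
proof -
  have "(\<Prod>j=1..m + n. f (concat_tuple m n \<sigma> \<sigma>' j))
      = (\<Prod>j=1..m. f (concat_tuple m n \<sigma> \<sigma>' j)) * (\<Prod>j=m + 1..m + n. f (concat_tuple m n \<sigma> \<sigma>' j))"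
    by (rule prod.ub_add_nat) simp
  also have "(\<Prod>j=m + 1..m + n. f (concat_tuple m n \<sigma> \<sigma>' j)) = (\<Prod>j=1..n. f (concat_tuple m n \<sigma> \<sigma>' (j + m)))"
    using prod.shift_bounds_cl_nat_ivl[of "\<lambda>j. f (concat_tuple m n \<sigma> \<sigma>' j)" 1 m n] by (simp add: add.commute)
  also have "\<dots> = (\<Prod>j=1..n. f (\<sigma>' j))"
    by (intro prod.cong refl) (auto simp: concat_tuple_def)
  also have "(\<Prod>j=1..m. f (concat_tuple m n \<sigma> \<sigma>' j)) = (\<Prod>j=1..m. f (\<sigma> j))"
    by (intro prod.cong refl) (auto simp: concat_tuple_def)
  finally show ?thesis .
qed

lemma B_val_less_A_val:
  assumes e: "1 \<le> e"
  shows "B_val e < A_val e"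
proof -
  obtain \<sigma> where \<sigma>: "\<sigma> \<in> scale_box e" and A: "0 < A_val e" "A_val e ^ 4 = 2 * Pprod e \<sigma> - pprod e \<sigma>"
    by (rule A_val_box)
  have "B_val e ^ 4 \<le> 2 * Pprod e \<sigma> - 2 * pprod e \<sigma> + qprod e \<sigma>"
    by (rule B_val_box[OF e]) (use \<sigma> in blast)
  then have "B_val e ^ 4 < A_val e ^ 4"
    using box_products(3)[OF \<sigma> e] A(2) by simp
  then show ?thesis using A(1) by (auto intro: power_less_imp_less_base)
qed

lemma B_val_submult:
  assumes e: "1 \<le> e1" "1 \<le> e2"
  shows "B_val (e1 + e2) < B_val e1 * B_val e2"
proof -
  obtain \<sigma>1 where 1: "\<sigma>1 \<in> scale_box e1" "0 < B_val e1"
      "B_val e1 ^ 4 = 2 * Pprod e1 \<sigma>1 - 2 * pprod e1 \<sigma>1 + qprod e1 \<sigma>1"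
      "\<And>\<sigma>'. \<sigma>' \<in> scale_box e1 \<Longrightarrow> B_val e1 ^ 4 \<le> 2 * Pprod e1 \<sigma>' - 2 * pprod e1 \<sigma>' + qprod e1 \<sigma>'"
    by (rule B_val_box[OF e(1)]) blast
  obtain \<sigma>2 where 2: "\<sigma>2 \<in> scale_box e2" "0 < B_val e2"
      "B_val e2 ^ 4 = 2 * Pprod e2 \<sigma>2 - 2 * pprod e2 \<sigma>2 + qprod e2 \<sigma>2"
      "\<And>\<sigma>'. \<sigma>' \<in> scale_box e2 \<Longrightarrow> B_val e2 ^ 4 \<le> 2 * Pprod e2 \<sigma>' - 2 * pprod e2 \<sigma>' + qprod e2 \<sigma>'"
    by (rule B_val_box[OF e(2)]) blast
  define P1 p1 q1 P2 p2 q2 where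
    "P1 = Pprod e1 \<sigma>1" "p1 = pprod e1 \<sigma>1" "q1 = qprod e1 \<sigma>1"
    "P2 = Pprod e2 \<sigma>2" "p2 = pprod e2 \<sigma>2" "q2 = qprod e2 \<sigma>2"
  note defs = this
  have x1: "3 * p1 < P1 + 2 * q1" and x2: "3 * p2 < P2 + 2 * q2"
    using minimizer_excess[OF e(1) 1(1)] minimizer_excess[OF e(2) 2(1)] 1 2 unfolding defs by auto
  have d: "p1 < P1" "p2 < P2" using box_products(2)[OF 1(1) e(1)] box_products(2)[OF 2(1) e(2)] by (simp_all add: defs)
  have e12: "1 \<le> e1 + e2" using e by simp
  let ?\<rho> = "concat_tuple e1 e2 \<sigma>1 \<sigma>2"
  \<comment> \<open>The concatenated minimisers need not be optimal in dimension
    \<open>e1 + e2\<close>; they give an upper bound whose three products factor.\<close>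
  have "B_val (e1 + e2) ^ 4 \<le> 2 * Pprod (e1 + e2) ?\<rho> - 2 * pprod (e1 + e2) ?\<rho> + qprod (e1 + e2) ?\<rho>"
    by (rule B_val_box[OF e12]) (use concat_tuple_box[OF 1(1) 2(1)] in blast)
  also have "\<dots> = 2 * (P1 * P2) - 2 * (p1 * p2) + q1 * q2"
    unfolding defs Pprod_def pprod_def qprod_def
    by (simp only: prod_concat_tuple[of "\<lambda>s. 1 + 2 * (1 - 1 / s)\<^sup>2"] prod_concat_tuple[of "\<lambda>s. 2 * s / 3"]
      prod_concat_tuple[of "\<lambda>s. 2 * (1 - 1 / (2 * s))\<^sup>2"])
  also have "\<dots> < (2 * P1 - 2 * p1 + q1) * (2 * P2 - 2 * p2 + q2)"
  proof -
    have "0 < (P1 - p1) * (P2 + 2 * q2 - 3 * p2) + (P2 - p2) * (P1 + 2 * q1 - 3 * p1)"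
      using d x1 x2 by (intro add_pos_pos mult_pos_pos) auto
    then show ?thesis by (simp add: algebra_simps)
  qed
  also have "\<dots> = (B_val e1 * B_val e2) ^ 4" by (simp add: 1(3) 2(3) defs power_mult_distrib)
  finally show ?thesis using 1(2) 2(2) by (auto intro: power_less_imp_less_base)
qed

theorem theorem6:
  shows "(\<forall>e::nat. 1 \<le> e \<longrightarrow> B_val e < A_val e) \<and>
    (\<forall>e1 e2 :: nat. 1 \<le> e1 \<longrightarrow> 1 \<le> e2 \<longrightarrow> B_val (e1 + e2) < B_val e1 * B_val e2)"
  using B_val_less_A_val B_val_submult by blast

end
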